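(* Consider Caching in Matchings where the online algorithm has $k+h$ matchings and the offline optimum has $k$ matchings, with $h\ge k-1$. Then there is a deterministic online algorithm that is $2\left(1+\frac{k-1}{\lfloor (h+3-k)/2\rfloor}\right)$-competitive. In particular, with $h=(1+\alpha)k$ extra matchings (for $\alpha>0$) the competitive ratio is $O(1+\frac{1}{\alpha})$.
   Context: Caching in Matchings with resource augmentation (general graphs): on a node set of size $n$, requests for edges arrive online. The online algorithm maintains a cache which is the union of $k+h$ matchings (a properly $(k+h)$-edge-colored edge set). If a requested edge is in none of its matchings, it must insert it into one of them, evicting from that matching the edges incident to its endpoints; it may also add any edge to any matching at any time (keeping each a matching) and evict freely. Each addition of an edge to a matching costs $1$. The offline optimum $OPT$ solves the same problem with only $k$ matchings. An online algorithm $A$ is $c$-competitive if there is a constant $d$ (independent of the sequence) with $\mathrm{cost}(A(\sigma))\le c\cdot\mathrm{cost}(OPT(\sigma))+d$ for every request sequence $\sigma$. *)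

theory Defs
  imports Complex_Main "HOL-Library.Disjoint_Sets"
begin

text \<open>Requests are arbitrary edges of the complete graph on the node set \<open>V\<close>.\<close>

definition edges :: "'v set \<Rightarrow> 'v set set" where
  "edges V = {e. e \<subseteq> V \<and> card e = 2}"

text \<open>
  A cache configuration assigns to each index \<open>i < m\<close> the \<open>i\<close>-th matching; the values at \<open>i \<ge> m\<close>
  are irrelevant. Disjointness of the matchings says that every cached edge has a single colour,
  so that a configuration is a properly \<open>m\<close>-edge-coloured edge set.
\<close>

type_synonym 'v config = "nat \<Rightarrow> 'v set set"

definition is_config :: "'v set \<Rightarrow> nat \<Rightarrow> 'v config \<Rightarrow> bool" where
  "is_config V m C \<longleftrightarrow>
     (\<forall>i<m. C i \<subseteq> edges V \<and> pairwise disjnt (C i)) \<and> disjoint_family_on C {..<m}"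

definition cached :: "nat \<Rightarrow> 'v config \<Rightarrow> 'v set set" where
  "cached m C = (\<Union>i<m. C i)"

text \<open>
  Evictions are free, so passing from \<open>C\<close> to \<open>C'\<close> costs the number of additions of an edge to a
  matching. Moving an edge from one matching to another is an eviction followed by an addition.
\<close>

definition switch_cost :: "nat \<Rightarrow> 'v config \<Rightarrow> 'v config \<Rightarrow> nat" where
  "switch_cost m C C' = (\<Sum>i<m. card (C' i - C i))"

text \<open>
  \<open>S t\<close> is the configuration in which the \<open>t\<close>-th request has just been served. Changes made
  after serving a request and before the next one arrives are accounted to the step to \<open>S (Suc t)\<close>.
\<close>

definition is_schedule :: "'v set \<Rightarrow> nat \<Rightarrow> 'v set list \<Rightarrow> (nat \<Rightarrow> 'v config) \<Rightarrow> bool" where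
  "is_schedule V m \<sigma> S \<longleftrightarrow>
     S 0 = (\<lambda>i. {}) \<and>
     (\<forall>t\<le>length \<sigma>. is_config V m (S t)) \<and>
     (\<forall>t<length \<sigma>. \<sigma> ! t \<in> cached m (S (Suc t)))"

definition schedule_cost :: "nat \<Rightarrow> 'v set list \<Rightarrow> (nat \<Rightarrow> 'v config) \<Rightarrow> nat" where
  "schedule_cost m \<sigma> S = (\<Sum>t<length \<sigma>. switch_cost m (S t) (S (Suc t)))"

text \<open>For \<open>k \<ge> 1\<close> the infimum is over a nonempty set of naturals, hence a minimum.\<close>

definition opt_cost :: "'v set \<Rightarrow> nat \<Rightarrow> 'v set list \<Rightarrow> nat" where
  "opt_cost V k \<sigma> = (INF S\<in>{S. is_schedule V k \<sigma> S}. schedule_cost k \<sigma> S)"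

lemma ex_schedule:
  assumes "k \<ge> 1" and "\<sigma> \<in> lists (edges V)"
  shows "\<exists>S. is_schedule V k \<sigma> S"
proof
  let ?S = "\<lambda>t i. if t = 0 \<or> i \<noteq> 0 then {} else {\<sigma> ! (t - 1)}"
  have "\<sigma> ! (t - 1) \<in> edges V" if "t \<le> length \<sigma>" "t \<noteq> 0" for t
    using that assms(2) by (auto simp: in_lists_conv_set)
  then show "is_schedule V k \<sigma> ?S"
    using assms(1)
    by (auto simp: is_schedule_def is_config_def cached_def disjoint_family_on_def pairwise_def)
qed

text \<open>
  A deterministic online algorithm maps the requests seen so far to the configuration reached after
  serving the last of them.
\<close>

type_synonym 'v algorithm = "'v set list \<Rightarrow> 'v config"

definition run :: "'v algorithm \<Rightarrow> 'v set list \<Rightarrow> nat \<Rightarrow> 'v config" where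
  "run A \<sigma> t = A (take t \<sigma>)"

definition is_online_algorithm :: "'v set \<Rightarrow> nat \<Rightarrow> 'v algorithm \<Rightarrow> bool" where
  "is_online_algorithm V m A \<longleftrightarrow> (\<forall>\<sigma>\<in>lists (edges V). is_schedule V m \<sigma> (run A \<sigma>))"

definition alg_cost :: "nat \<Rightarrow> 'v algorithm \<Rightarrow> 'v set list \<Rightarrow> nat" where
  "alg_cost m A \<sigma> = schedule_cost m \<sigma> (run A \<sigma>)"

definition competitive :: "'v set \<Rightarrow> nat \<Rightarrow> nat \<Rightarrow> real \<Rightarrow> 'v algorithm \<Rightarrow> bool" where
  "competitive V m k c A \<longleftrightarrow>
     (\<exists>d::real. \<forall>\<sigma>\<in>lists (edges V). real (alg_cost m A \<sigma>) \<le> c * real (opt_cost V k \<sigma>) + d)"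

end

theory Submission
  imports Defs
begin

text \<open>
  Every node runs flush-when-full paging with capacity \<open>D = (k + h + 1) div 2\<close> on the requests
  incident to it, and an edge is kept as long as both its endpoints keep it. When an edge has to be
  inserted, each endpoint has at most \<open>D - 1\<close> other cached edges, so at most \<open>2D - 2 < k + h\<close>
  colours are blocked and no recolouring is ever needed. The offline cache has at most \<open>k\<close> edges at
  every node, so the paging bound \<open>D / (D - k + 1)\<close> applies at every node; since every offline
  insertion is counted at two nodes, a factor of 2 is lost.
\<close>

section \<open>Flush-when-full paging\<close>

text \<open>Nothing is evicted one by one: the set consists of the distinct items requested in the
  current phase, and a fault on a full set starts a new phase with \<open>e\<close> alone. This
  makes the faults exactly countable, \<open>D\<close> per completed phase.\<close>

definition fwf :: "nat \<Rightarrow> 'a \<Rightarrow> 'a set \<Rightarrow> 'a set" where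
  "fwf D e M = (if e \<in> M then M else if card M \<ge> D then {e} else insert e M)"

lemma fwf_mem [simp]: "e \<in> fwf D e M"
  by (simp add: fwf_def)

lemma fwf_subset: "fwf D e M \<subseteq> insert e M"
  by (auto simp: fwf_def)

lemma finite_fwf: "finite M \<Longrightarrow> finite (fwf D e M)"
  by (simp add: fwf_def)

lemma card_fwf_le:
  assumes "finite M" "card M \<le> D" "D \<ge> 1"
  shows "card (fwf D e M) \<le> D"
  using assms by (auto simp: fwf_def card_insert_if)

text \<open>
  \<open>p\<close> is the number of completed phases and \<open>B\<close> is the offline cache at the start of the current
  phase: everything marked in this phase and absent from \<open>B\<close> was added by the offline algorithm.
\<close>

lemma fwf_phases:
  fixes M C :: "nat \<Rightarrow> 'a set" and r :: "nat \<Rightarrow> 'a"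
  assumes k: "k \<le> D" "D \<ge> 1"
    and init: "M 0 = {}" "C 0 = {}"
    and C: "\<And>t. t \<le> T \<Longrightarrow> finite (C t) \<and> card (C t) \<le> k"
    and M: "\<And>t. t < T \<Longrightarrow> M (Suc t) = (if act t then fwf D (r t) (M t) else M t)"
    and served: "\<And>t. t < T \<Longrightarrow> act t \<Longrightarrow> r t \<in> C (Suc t)"
    and "t \<le> T"
  shows "\<exists>B p. finite B \<and> card B \<le> k \<and> finite (M t) \<and> card (M t) \<le> D \<and>
    (D + 1 - k) * p + card (M t \<union> C t - B) \<le> (\<Sum>s<t. card (C (Suc s) - C s)) \<and>
    (\<Sum>s<t. of_bool (act s \<and> r s \<notin> M s)) = D * p + card (M t)"
  using \<open>t \<le> T\<close>
proof (induction t)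
  case 0
  show ?case by (rule exI[of _ "{}"], rule exI[of _ 0]) (simp add: init)
next
  case (Suc t)
  then obtain B p where B: "finite B" "card B \<le> k" and finM: "finite (M t)" and D: "card (M t) \<le> D"
    and O: "(D + 1 - k) * p + card (M t \<union> C t - B) \<le> (\<Sum>s<t. card (C (Suc s) - C s))"
    and F: "(\<Sum>s<t. of_bool (act s \<and> r s \<notin> M s)) = D * p + card (M t)"
    by auto
  have t: "t < T" using Suc.prems by simp
  have finC: "finite (C t)" "finite (C (Suc t))" and cardC: "card (C (Suc t)) \<le> k"
    using C Suc.prems by auto
  \<comment> \<open>Whatever is in \<open>C (Suc t)\<close> but not in \<open>C t\<close> was paid
    for by the offline algorithm in this step.\<close>
  have "card (M t \<union> C (Suc t) - B) \<le> card ((M t \<union> C t - B) \<union> (C (Suc t) - C t))"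
    using finM finC by (intro card_mono) auto
  also have "\<dots> \<le> card (M t \<union> C t - B) + card (C (Suc t) - C t)"
    by (rule card_Un_le)
  finally have O': "(D + 1 - k) * p + card (M t \<union> C (Suc t) - B)
      \<le> (\<Sum>s<Suc t. card (C (Suc s) - C s))"
    using O by simp
  show ?case
  \<comment> \<open>Since \<open>card (M t) \<le> D\<close>, the test \<open>card M \<ge> D\<close>
    in \<open>fwf\<close> amounts to equality, so this is exactly the case of a flush.\<close>
  proof (cases "act t \<and> r t \<notin> M t \<and> card (M t) = D")
    case True
    then have M': "M (Suc t) = {r t}" using M[OF t] by (simp add: fwf_def)
    \<comment> \<open>The marked items and the new request are \<open>D + 1\<close> distinct items.
      At most \<open>k\<close> of them lie in \<open>B\<close>, so the phase has cost the offline
      algorithm at least \<open>D + 1 - k\<close>, which pays for the increment of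
      \<open>p\<close>.\<close>
    have "D + 1 = card (insert (r t) (M t))" using True finM by simp
    also have "\<dots> \<le> card ((M t \<union> C (Suc t) - B) \<union> B)"
      using served[OF t] True finM finC B by (intro card_mono) auto
    also have "\<dots> \<le> card (M t \<union> C (Suc t) - B) + card B"
      by (rule card_Un_le)
    finally have "D + 1 - k \<le> card (M t \<union> C (Suc t) - B)" using B by simp
    with O' have "(D + 1 - k) * (p + 1) \<le> (\<Sum>s<Suc t. card (C (Suc s) - C s))"
      by (simp add: algebra_simps)
    \<comment> \<open>The new phase takes \<open>C (Suc t)\<close> for \<open>B\<close>. It already
      contains \<open>r t\<close>, so the count starts at zero.\<close>
    moreover have "M (Suc t) \<union> C (Suc t) - C (Suc t) = {}"
      using M' served[OF t] True by auto
    moreover have "(\<Sum>s<Suc t. of_bool (act s \<and> r s \<notin> M s)) = D * (p + 1) + card (M (Suc t))"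
      using F True M' by simp
    ultimately show ?thesis
      using finC cardC k M' by (intro exI[of _ "C (Suc t)"] exI[of _ "p + 1"]) simp
  next
    case False
    then have M': "M (Suc t) = (if act t then insert (r t) (M t) else M t)"
      using M[OF t] D by (auto simp: fwf_def)
    \<comment> \<open>Marking \<open>r t\<close> does not enlarge the union, because the offline
      cache holds \<open>r t\<close> after serving it.\<close>
    have "M (Suc t) \<union> C (Suc t) - B = M t \<union> C (Suc t) - B"
      using M' served[OF t] by auto
    moreover have "card (M (Suc t)) \<le> D" "card (M (Suc t)) = card (M t) + of_bool (act t \<and> r t \<notin> M t)"
      using M' False D finM by (auto simp: card_insert_if)
    moreover have "finite (M (Suc t))" using M' finM by simp
    ultimately show ?thesis
      using O' B F by (intro exI[of _ B] exI[of _ p]) simp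
  qed
qed

text \<open>Eliminates the number \<open>p\<close> of phases between the two bounds of
  \<open>fwf_phases\<close>; the additive term pays for the unfinished last phase. The predicate
  \<open>act\<close> selects the requests that concern a given node, while \<open>C\<close> may
  change at every step. The factor \<open>D + 1 - k\<close> is multiplied out to stay in the
  naturals.\<close>

lemma fwf_competitive:
  fixes M C :: "nat \<Rightarrow> 'a set" and r :: "nat \<Rightarrow> 'a"
  assumes "k \<le> D" "D \<ge> 1"
    and "M 0 = {}" "C 0 = {}"
    and "\<And>t. t \<le> T \<Longrightarrow> finite (C t) \<and> card (C t) \<le> k"
    and "\<And>t. t < T \<Longrightarrow> M (Suc t) = (if act t then fwf D (r t) (M t) else M t)"
    and "\<And>t. t < T \<Longrightarrow> act t \<Longrightarrow> r t \<in> C (Suc t)"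
  shows "(D + 1 - k) * (\<Sum>s<T. of_bool (act s \<and> r s \<notin> M s))
    \<le> D * (\<Sum>s<T. card (C (Suc s) - C s)) + (D + 1 - k) * D"
proof -
  obtain p where D: "card (M T) \<le> D"
    and O: "(D + 1 - k) * p \<le> (\<Sum>s<T. card (C (Suc s) - C s))"
    and F: "(\<Sum>s<T. of_bool (act s \<and> r s \<notin> M s)) = D * p + card (M T)"
    using fwf_phases[of k D M C T act r T] assms by fastforce
  have "(D + 1 - k) * (D * p + card (M T)) \<le> D * ((D + 1 - k) * p) + (D + 1 - k) * D"
    using mult_le_mono2[OF D, of "D + 1 - k"]
    by (simp only: distrib_left mult.left_commute[of D "D + 1 - k" p] add_le_cancel_left)
  also have "\<dots> \<le> D * (\<Sum>s<T. card (C (Suc s) - C s)) + (D + 1 - k) * D"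
    using mult_le_mono2[OF O] by simp
  finally show ?thesis by (simp only: F)
qed

section \<open>Edge sets and configurations\<close>

lemma edges_nonempty: "e \<in> edges V \<Longrightarrow> e \<noteq> {}"
  by (auto simp: edges_def)

lemma finite_edges: "finite V \<Longrightarrow> finite (edges V)"
  by (rule finite_subset[of _ "Pow V"]) (auto simp: edges_def)

lemma cached_subset_edges: "is_config V m C \<Longrightarrow> cached m C \<subseteq> edges V"
  by (auto simp: is_config_def cached_def)

text \<open>Each of the \<open>m\<close> matchings contains at most one edge at \<open>v\<close>.
  This is what bounds the offline paging cache at a node by \<open>k\<close>.\<close>

lemma config_degree_le:
  assumes "is_config V m C"
  shows "card {f \<in> cached m C. v \<in> f} \<le> m"
proof -
  have "card {f \<in> C i. v \<in> f} \<le> 1" if "i < m" for i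
  proof -
    have "f = g" if "f \<in> C i" "g \<in> C i" "v \<in> f" "v \<in> g" for f g
      using assms \<open>i < m\<close> that unfolding is_config_def pairwise_def disjnt_def by blast
    \<comment> \<open>In the infinite case \<open>card\<close> is 0 by convention.\<close>
    then show ?thesis
      by (cases "finite {f \<in> C i. v \<in> f}") (auto simp: card_le_Suc0_iff_eq)
  qed
  moreover have "{f \<in> cached m C. v \<in> f} = (\<Union>i<m. {f \<in> C i. v \<in> f})"
    by (auto simp: cached_def)
  ultimately show ?thesis
    using card_UN_le[of "{..<m}" "\<lambda>i. {f \<in> C i. v \<in> f}"]
      sum_bounded_above[of "{..<m}" "\<lambda>i. card {f \<in> C i. v \<in> f}" 1] by simp
qed

text \<open>Handshake lemma: every edge is counted at its two endpoints. The factor 2 of the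
  competitive ratio comes from here.\<close>

lemma sum_degrees:
  assumes "finite V" "X \<subseteq> edges V"
  shows "(\<Sum>v\<in>V. card {f \<in> X. v \<in> f}) = 2 * card X"
proof (rule sum_multicount)
  show "finite X" using assms finite_edges finite_subset by blast
  have "{i \<in> V. i \<in> f} = f" if "f \<in> X" for f
    using that assms by (auto simp: edges_def)
  then show "\<forall>f\<in>X. card {i \<in> V. i \<in> f} = 2"
    using assms by (auto simp: edges_def)
qed fact

text \<open>Only an inequality, since moving an edge to another colour costs 1 without changing the
  cached set. It suffices for bounding the offline cost from below.\<close>

lemma card_cached_diff_le_switch_cost:
  assumes "finite V" "is_config V m C'"
  shows "card (cached m C' - cached m C) \<le> switch_cost m C C'"
proof -
  have "finite (C' i)" if "i < m" for i
    using assms that finite_edges finite_subset unfolding is_config_def by blast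
  then have "card (cached m C' - cached m C) \<le> card (\<Union>i<m. C' i - C i)"
    by (intro card_mono) (auto simp: cached_def)
  also have "\<dots> \<le> switch_cost m C C'"
    unfolding switch_cost_def by (rule card_UN_le) simp
  finally show ?thesis .
qed

lemma opt_cost_attained:
  assumes "k \<ge> 1" "\<sigma> \<in> lists (edges V)"
  obtains S where "is_schedule V k \<sigma> S" "opt_cost V k \<sigma> = schedule_cost k \<sigma> S"
proof -
  have "opt_cost V k \<sigma> \<in> schedule_cost k \<sigma> ` {S. is_schedule V k \<sigma> S}"
    unfolding opt_cost_def using ex_schedule[OF assms] by (intro Inf_nat_def1) auto
  then show ?thesis using that by auto
qed

section \<open>The online algorithm\<close>

definition survivors :: "('v \<Rightarrow> 'v set set) \<Rightarrow> 'v set set" where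
  "survivors M = {f. \<forall>v\<in>f. f \<in> M v}"

definition mark :: "nat \<Rightarrow> 'v set \<Rightarrow> ('v \<Rightarrow> 'v set set) \<Rightarrow> 'v \<Rightarrow> 'v set set" where
  "mark D e M v = (if v \<in> e then fwf D e (M v) else M v)"

definition free_colour :: "nat \<Rightarrow> 'v set \<Rightarrow> 'v config \<Rightarrow> nat" where
  "free_colour m e C = (SOME j. j < m \<and> (\<forall>f\<in>C j. disjnt e f))"

definition place :: "nat \<Rightarrow> 'v set \<Rightarrow> 'v config \<Rightarrow> 'v config" where
  "place m e C = (if e \<in> cached m C then C
     else C(free_colour m e C := insert e (C (free_colour m e C))))"

text \<open>The marks are updated first, then every edge dropped by one of its endpoints is evicted,
  then \<open>e\<close> is inserted. An evicted edge may stay marked at its other endpoint: the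
  nodes thus page independently of each other and of the colouring.\<close>

definition serve :: "nat \<Rightarrow> nat \<Rightarrow> ('v \<Rightarrow> 'v set set) \<times> 'v config \<Rightarrow> 'v set
    \<Rightarrow> ('v \<Rightarrow> 'v set set) \<times> 'v config" where
  "serve m D s e =
     (mark D e (fst s), place m e (\<lambda>i. snd s i \<inter> survivors (mark D e (fst s))))"

definition state :: "nat \<Rightarrow> nat \<Rightarrow> 'v set list \<Rightarrow> ('v \<Rightarrow> 'v set set) \<times> 'v config" where
  "state m D \<sigma> = foldl (serve m D) (\<lambda>_. {}, \<lambda>_. {}) \<sigma>"

text \<open>Both inclusions of the equation matter: cached edges are marked at both endpoints, which
  bounds the blocked colours, and edges marked at both endpoints are cached, so requesting them is
  free.\<close>

definition consistent :: "'v set \<Rightarrow> nat \<Rightarrow> nat \<Rightarrow> ('v \<Rightarrow> 'v set set) \<times> 'v config \<Rightarrow> bool" where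
  "consistent V m D s \<longleftrightarrow> is_config V m (snd s) \<and> cached m (snd s) = edges V \<inter> survivors (fst s) \<and>
     (\<forall>v. finite (fst s v) \<and> card (fst s v) \<le> D)"

section \<open>Free colours and the invariant of the algorithm\<close>

text \<open>Otherwise one blocking edge per colour gives \<open>m\<close> distinct edges, the colour
  classes being disjoint. Here \<open>e\<close> is already marked at both endpoints, so it takes one
  of the \<open>D\<close> places there and leaves at most \<open>2 * (D - 1) < m\<close> blocking
  edges.\<close>

lemma free_colour_exists:
  assumes C: "is_config V m C" and e: "e \<in> edges V" "e \<notin> cached m C"
    and M: "\<And>v. v \<in> e \<Longrightarrow> finite (M v) \<and> card (M v) \<le> D \<and> e \<in> M v"
    and sub: "cached m C \<subseteq> survivors M"
    and m: "2 * D - 1 \<le> m" "D \<ge> 1"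
  shows "\<exists>j<m. \<forall>f\<in>C j. disjnt e f"
proof (rule ccontr)
  assume "\<not> ?thesis"
  then have "\<forall>j<m. \<exists>f. f \<in> C j \<and> \<not> disjnt e f" by blast
  then obtain g where g: "\<And>j. j < m \<Longrightarrow> g j \<in> C j \<and> \<not> disjnt e (g j)"
    by metis
  obtain u v where uv: "e = {u, v}"
    using e by (auto simp: edges_def card_2_iff)
  \<comment> \<open>A blocking edge meets \<open>e\<close> in \<open>u\<close> or \<open>v\<close>
    and, being cached, is marked there; it differs from \<open>e\<close>, which is not
    cached.\<close>
  have "g ` {..<m} \<subseteq> (M u - {e}) \<union> (M v - {e})"
  proof
    fix f assume "f \<in> g ` {..<m}"
    then have "f \<in> cached m C" "\<not> disjnt e f" using g by (auto simp: cached_def)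
    then show "f \<in> (M u - {e}) \<union> (M v - {e})"
      using sub e uv by (auto simp: survivors_def disjnt_def)
  qed
  then have "card (g ` {..<m}) \<le> card ((M u - {e}) \<union> (M v - {e}))"
    using M uv by (intro card_mono) auto
  also have "\<dots> \<le> card (M u - {e}) + card (M v - {e})"
    by (rule card_Un_le)
  also have "\<dots> \<le> (D - 1) + (D - 1)"
    using M[of u] M[of v] uv by (intro add_mono) (simp_all add: diff_le_mono)
  finally have "card (g ` {..<m}) < m" using m by linarith
  moreover have "inj_on g {..<m}"
  proof (rule inj_onI)
    fix i j assume "i \<in> {..<m}" "j \<in> {..<m}" "g i = g j"
    then show "i = j"
      using g[of i] g[of j] disjoint_family_onD[of C "{..<m}" i j] C
      by (cases "i = j") (auto simp: is_config_def)
  qed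
  ultimately show False by (simp add: card_image)
qed

text \<open>At most one class changes, by gaining an edge disjoint from all its members, and nothing
  is evicted.\<close>

lemma place_config:
  assumes C: "is_config V m C" and e: "e \<in> edges V"
    and free: "e \<notin> cached m C \<Longrightarrow> \<exists>j<m. \<forall>f\<in>C j. disjnt e f"
  shows "is_config V m (place m e C)"
    and "cached m (place m e C) = insert e (cached m C)"
    and "switch_cost m C (place m e C) \<le> of_bool (e \<notin> cached m C)"
proof -
  let ?j = "free_colour m e C"
  have j: "?j < m \<and> (\<forall>f\<in>C ?j. disjnt e f)" if "e \<notin> cached m C"
    using free[OF that] unfolding free_colour_def by (rule someI_ex)
  show "is_config V m (place m e C)"
  proof (cases "e \<in> cached m C")
    case False
    have "pairwise disjnt (insert e (C ?j))"
      using j[OF False] C by (auto simp: is_config_def pairwise_insert disjnt_sym)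
    then show ?thesis
      using C e j[OF False] False
      unfolding is_config_def disjoint_family_on_def place_def cached_def by auto
  qed (use C in \<open>simp add: place_def\<close>)
  show "cached m (place m e C) = insert e (cached m C)"
  proof (cases "e \<in> cached m C")
    case False
    with j show ?thesis by (auto simp: place_def cached_def split: if_splits)
  qed (auto simp: place_def)
  show "switch_cost m C (place m e C) \<le> of_bool (e \<notin> cached m C)"
  proof (cases "e \<in> cached m C")
    case False
    have "switch_cost m C (place m e C) \<le> (\<Sum>i<m. of_bool (i = ?j))"
      unfolding switch_cost_def
    proof (rule sum_mono)
      fix i
      have "place m e C i - C i \<subseteq> (if i = ?j then {e} else {})"
        using False by (auto simp: place_def)
      then have "card (place m e C i - C i) \<le> card (if i = ?j then {e} else {})"
        by (intro card_mono) auto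
      then show "card (place m e C i - C i) \<le> of_bool (i = ?j)" by (auto split: if_splits)
    qed
    also have "\<dots> \<le> 1" by (simp add: of_bool_def)
    finally show ?thesis using False by simp
  qed (simp add: place_def switch_cost_def)
qed

text \<open>By the invariant a request can cost something only if some endpoint does not mark the
  edge, that is, if some endpoint faults.\<close>

lemma serve_consistent:
  assumes s: "consistent V m D s" and e: "e \<in> edges V" and m: "2 * D - 1 \<le> m" "D \<ge> 1"
  shows "consistent V m D (serve m D s e)"
    and "e \<in> cached m (snd (serve m D s e))"
    and "switch_cost m (snd s) (snd (serve m D s e)) \<le> of_bool (\<exists>v\<in>e. e \<notin> fst s v)"
proof -
  define M' where "M' = mark D e (fst s)"
  define C where "C = (\<lambda>i. snd s i \<inter> survivors M')"
  have serve: "serve m D s e = (M', place m e C)"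
    by (simp add: serve_def M'_def C_def)
  have config: "is_config V m (snd s)" and cached: "cached m (snd s) = edges V \<inter> survivors (fst s)"
    and marks: "\<And>v. finite (fst s v) \<and> card (fst s v) \<le> D"
    using s by (auto simp: consistent_def)
  have marks': "finite (M' v) \<and> card (M' v) \<le> D" for v
    using marks m by (auto simp: M'_def mark_def finite_fwf card_fwf_le)
  have eM': "e \<in> M' v" if "v \<in> e" for v
    using that by (simp add: M'_def mark_def)
  have "M' v \<subseteq> insert e (fst s v)" for v
    using fwf_subset[of D e "fst s v"] by (auto simp: M'_def mark_def)
  \<comment> \<open>Serving a request adds no mark other than \<open>e\<close>, so no other edge can
    begin to survive, and inserting \<open>e\<close> alone restores the invariant.\<close>
  then have survivors': "survivors M' \<subseteq> insert e (survivors (fst s))"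
    unfolding survivors_def by blast
  have e_survives: "e \<in> survivors M'"
    using eM' by (simp add: survivors_def)
  have C: "is_config V m C"
    unfolding is_config_def
  proof (intro conjI allI impI)
    fix i assume "i < m"
    then show "C i \<subseteq> edges V" "pairwise disjnt (C i)"
      using config pairwise_subset[of disjnt "snd s i" "C i"] by (auto simp: is_config_def C_def)
  next
    show "disjoint_family_on C {..<m}"
      using config
      by (simp add: is_config_def C_def disjoint_family_on_def disjoint_iff)
  qed
  have cachedC: "cached m C = cached m (snd s) \<inter> survivors M'"
    by (auto simp: C_def cached_def)
  have "\<exists>j<m. \<forall>f\<in>C j. disjnt e f" if "e \<notin> cached m C"
    using free_colour_exists[OF C e that, of M' D] marks' eM' cachedC m by blast
  note place = place_config[OF C e this]
  have cached': "cached m (place m e C) = edges V \<inter> survivors M'"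
    using place(2) cachedC cached survivors' e e_survives by auto
  show "consistent V m D (serve m D s e)"
    using place(1) cached' marks' by (simp add: consistent_def serve)
  show "e \<in> cached m (snd (serve m D s e))"
    using place(2) by (simp add: serve)
  have hit: "e \<in> cached m C \<longleftrightarrow> (\<forall>v\<in>e. e \<in> fst s v)"
    using cachedC cached e e_survives by (auto simp: survivors_def)
  \<comment> \<open>The evictions are free: no edge filtered out by \<open>survivors M'\<close> is
    put back, since \<open>place\<close> adds only \<open>e\<close>, which survives.\<close>
  have "switch_cost m (snd s) (place m e C) = switch_cost m C (place m e C)"
    unfolding switch_cost_def
  proof (rule sum.cong)
    fix i assume "i \<in> {..<m}"
    then have "place m e C i \<subseteq> survivors M'"
      using e_survives by (auto simp: place_def C_def)
    then have "place m e C i - snd s i = place m e C i - C i"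
      by (auto simp: C_def)
    then show "card (place m e C i - snd s i) = card (place m e C i - C i)" by simp
  qed simp
  also have "\<dots> \<le> of_bool (\<exists>v\<in>e. e \<notin> fst s v)"
    using place(3) hit by auto
  finally show "switch_cost m (snd s) (snd (serve m D s e)) \<le> of_bool (\<exists>v\<in>e. e \<notin> fst s v)"
    by (simp add: serve)
qed

lemma state_Nil [simp]: "state m D [] = (\<lambda>_. {}, \<lambda>_. {})"
  by (simp add: state_def)

lemma state_snoc [simp]: "state m D (\<sigma> @ [e]) = serve m D (state m D \<sigma>) e"
  by (simp add: state_def)

lemma state_consistent:
  assumes "2 * D - 1 \<le> m" "D \<ge> 1" "\<sigma> \<in> lists (edges V)"
  shows "consistent V m D (state m D \<sigma>)"
  using assms(3)
proof (induction \<sigma> rule: rev_induct)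
  case Nil
  \<comment> \<open>Without marks the only survivor is the empty set, vacuously, and it is not an
    edge.\<close>
  show ?case
    using edges_nonempty[of _ V]
    by (auto simp: consistent_def is_config_def cached_def survivors_def disjoint_family_on_def)
next
  case (snoc e \<sigma>)
  then show ?case by (simp add: serve_consistent(1)[OF _ _ assms(1,2)])
qed

lemma in_lists_take: "\<sigma> \<in> lists A \<Longrightarrow> take t \<sigma> \<in> lists A"
  by (auto simp: in_lists_conv_set dest: in_set_takeD)

lemma state_take_Suc:
  "t < length \<sigma> \<Longrightarrow> state m D (take (Suc t) \<sigma>) = serve m D (state m D (take t \<sigma>)) (\<sigma> ! t)"
  by (simp add: take_Suc_conv_app_nth)

lemma state_online:
  assumes "2 * D - 1 \<le> m" "D \<ge> 1"
  shows "is_online_algorithm V m (\<lambda>\<sigma>. snd (state m D \<sigma>))"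
  unfolding is_online_algorithm_def is_schedule_def run_def
proof (intro ballI conjI allI impI)
  fix \<sigma> t assume \<sigma>: "\<sigma> \<in> lists (edges V)"
  note cons = state_consistent[OF assms in_lists_take[OF \<sigma>]]
  show "is_config V m (snd (state m D (take t \<sigma>)))"
    using cons by (simp add: consistent_def)
  assume "t < length \<sigma>"
  then show "\<sigma> ! t \<in> cached m (snd (state m D (take (Suc t) \<sigma>)))"
    using serve_consistent(2)[OF cons _ assms] \<sigma> by (simp add: state_take_Suc in_lists_conv_set)
qed simp

section \<open>Comparison with the offline optimum, node by node\<close>

text \<open>Every insertion is charged to a faulting endpoint. If both endpoints fault it is counted
  twice, hence an inequality.\<close>

lemma alg_cost_le_faults:
  assumes "2 * D - 1 \<le> m" "D \<ge> 1" "finite V" and \<sigma>: "\<sigma> \<in> lists (edges V)"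
  shows "alg_cost m (\<lambda>\<sigma>. snd (state m D \<sigma>)) \<sigma> \<le>
    (\<Sum>v\<in>V. \<Sum>t<length \<sigma>. of_bool (v \<in> \<sigma> ! t \<and> \<sigma> ! t \<notin> fst (state m D (take t \<sigma>)) v))"
  unfolding alg_cost_def schedule_cost_def run_def sum.swap[of _ _ V]
proof (rule sum_mono)
  fix t assume "t \<in> {..<length \<sigma>}"
  then have t: "t < length \<sigma>" by simp
  let ?e = "\<sigma> ! t" and ?s = "state m D (take t \<sigma>)"
  have e: "?e \<in> edges V" using t \<sigma> by (simp add: in_lists_conv_set)
  have "switch_cost m (snd ?s) (snd (serve m D ?s ?e)) \<le> of_bool (\<exists>v\<in>?e. ?e \<notin> fst ?s v)"
    by (rule serve_consistent(3)[OF state_consistent[OF assms(1,2) in_lists_take[OF \<sigma>]] e assms(1,2)])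
  also have "\<dots> \<le> (\<Sum>v\<in>V. of_bool (v \<in> ?e \<and> ?e \<notin> fst ?s v))"
  proof (cases "\<exists>v\<in>?e. ?e \<notin> fst ?s v")
    case True
    then obtain v where v: "v \<in> ?e" "?e \<notin> fst ?s v" by blast
    with e have "v \<in> V" by (auto simp: edges_def)
    then show ?thesis
      using member_le_sum[of v V "\<lambda>v. of_bool (v \<in> ?e \<and> ?e \<notin> fst ?s v) :: nat"] v assms(3)
      by auto
  qed simp
  finally show "switch_cost m (snd ?s) (snd (state m D (take (Suc t) \<sigma>)))
      \<le> (\<Sum>v\<in>V. of_bool (v \<in> ?e \<and> ?e \<notin> fst ?s v))"
    using t by (simp add: state_take_Suc)
qed

text \<open>The paging bound is applied at each node, with the optimal schedule restricted to the
  edges at that node as the offline cache, and summed over \<open>V\<close>.\<close>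

lemma alg_cost_le_opt_cost:
  assumes m: "2 * D - 1 \<le> m" "1 \<le> k" "k \<le> D" and V: "finite V" and \<sigma>: "\<sigma> \<in> lists (edges V)"
  shows "(D + 1 - k) * alg_cost m (\<lambda>\<sigma>. snd (state m D \<sigma>)) \<sigma>
    \<le> 2 * D * opt_cost V k \<sigma> + (D + 1 - k) * D * card V"
proof -
  have D: "D \<ge> 1" using m by simp
  obtain S where S: "is_schedule V k \<sigma> S" "opt_cost V k \<sigma> = schedule_cost k \<sigma> S"
    using opt_cost_attained[OF m(2) \<sigma>] .
  have config: "is_config V k (S t)" if "t \<le> length \<sigma>" for t
    using S(1) that by (simp add: is_schedule_def)
  define M where "M v t = fst (state m D (take t \<sigma>)) v" for v t
  define C where "C v t = {f \<in> cached k (S t). v \<in> f}" for v t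
  let ?F = "\<lambda>v. \<Sum>t<length \<sigma>. of_bool (v \<in> \<sigma> ! t \<and> \<sigma> ! t \<notin> M v t) :: nat"
  let ?O = "\<lambda>v. \<Sum>t<length \<sigma>. card (C v (Suc t) - C v t)"
  have node: "(D + 1 - k) * ?F v \<le> D * ?O v + (D + 1 - k) * D" for v
  proof (rule fwf_competitive)
    show "M v 0 = {}" by (simp add: M_def)
    show "C v 0 = {}" using S(1) by (simp add: C_def is_schedule_def cached_def)
    show "finite (C v t) \<and> card (C v t) \<le> k" if "t \<le> length \<sigma>" for t
      using config_degree_le[OF config[OF that]] cached_subset_edges[OF config[OF that]]
        finite_edges[OF V] finite_subset by (fastforce simp: C_def)
    show "M v (Suc t) = (if v \<in> \<sigma> ! t then fwf D (\<sigma> ! t) (M v t) else M v t)"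
      if "t < length \<sigma>" for t
      using that by (simp add: M_def state_take_Suc serve_def mark_def)
    show "\<sigma> ! t \<in> C v (Suc t)" if "t < length \<sigma>" "v \<in> \<sigma> ! t" for t
      using that S(1) by (simp add: C_def is_schedule_def)
  qed (use m D in auto)
  have "(\<Sum>v\<in>V. ?O v) = (\<Sum>t<length \<sigma>. \<Sum>v\<in>V. card (C v (Suc t) - C v t))"
    by (rule sum.swap)
  also have "\<dots> \<le> (\<Sum>t<length \<sigma>. 2 * switch_cost k (S t) (S (Suc t)))"
  proof (rule sum_mono)
    fix t assume "t \<in> {..<length \<sigma>}"
    then have c: "is_config V k (S (Suc t))" using config by simp
    \<comment> \<open>The offline additions at \<open>v\<close> are the newly cached edges incident
      to \<open>v\<close>, so \<open>sum_degrees\<close> sums them up.\<close>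
    have "C v (Suc t) - C v t = {f \<in> cached k (S (Suc t)) - cached k (S t). v \<in> f}" for v
      by (auto simp: C_def)
    then have "(\<Sum>v\<in>V. card (C v (Suc t) - C v t)) = 2 * card (cached k (S (Suc t)) - cached k (S t))"
      using sum_degrees[OF V, of "cached k (S (Suc t)) - cached k (S t)"] cached_subset_edges[OF c]
      by auto
    then show "(\<Sum>v\<in>V. card (C v (Suc t) - C v t)) \<le> 2 * switch_cost k (S t) (S (Suc t))"
      using card_cached_diff_le_switch_cost[OF V c, of "S t"] by simp
  qed
  also have "\<dots> = 2 * opt_cost V k \<sigma>"
    by (simp add: S(2) schedule_cost_def sum_distrib_left)
  finally have O: "(\<Sum>v\<in>V. ?O v) \<le> 2 * opt_cost V k \<sigma>" .
  have "(D + 1 - k) * alg_cost m (\<lambda>\<sigma>. snd (state m D \<sigma>)) \<sigma> \<le> (D + 1 - k) * (\<Sum>v\<in>V. ?F v)"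
    using alg_cost_le_faults[OF m(1) D V \<sigma>] by (intro mult_le_mono2) (simp add: M_def)
  also have "\<dots> \<le> (\<Sum>v\<in>V. D * ?O v + (D + 1 - k) * D)"
    unfolding sum_distrib_left[of "D + 1 - k" _ V] by (rule sum_mono) (rule node)
  also have "\<dots> = D * (\<Sum>v\<in>V. ?O v) + (D + 1 - k) * D * card V"
    by (simp add: sum.distrib sum_distrib_left)
  also have "\<dots> \<le> 2 * D * opt_cost V k \<sigma> + (D + 1 - k) * D * card V"
    using mult_le_mono2[OF O, of D] by (simp add: mult.assoc mult.left_commute)
  finally show ?thesis .
qed

section \<open>The competitive ratio and the choice of the capacity\<close>

text \<open>Division by \<open>q = D + 1 - k\<close> turns the bound into the ratio
  \<open>2 * D / q\<close>, where \<open>D = q + (k - 1)\<close>. The additive constant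
  \<open>D * card V\<close> does not depend on the requests.\<close>

lemma state_competitive:
  assumes "2 * D - 1 \<le> m" "1 \<le> k" "k \<le> D" "finite V"
  shows "competitive V m k (2 * (1 + (real k - 1) / (real D + 1 - real k)))
    (\<lambda>\<sigma>. snd (state m D \<sigma>))"
  unfolding competitive_def
proof (intro exI ballI)
  fix \<sigma> assume \<sigma>: "\<sigma> \<in> lists (edges V)"
  define q where "q = D + 1 - k"
  have q: "real q = real D + 1 - real k" "q > 0"
    using assms by (auto simp: q_def)
  let ?a = "real (alg_cost m (\<lambda>\<sigma>. snd (state m D \<sigma>)) \<sigma>)" and ?o = "real (opt_cost V k \<sigma>)"
  have "real q * ?a \<le> 2 * real D * ?o + real q * real D * real (card V)"
    using of_nat_mono[OF alg_cost_le_opt_cost[OF assms \<sigma>, folded q_def], where 'a = real]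
    by (simp only: of_nat_add of_nat_mult of_nat_numeral)
  then have "?a \<le> 2 * (real D / real q) * ?o + real D * real (card V)"
    using q(2) by (simp add: field_simps)
  also have "real D / real q = 1 + (real k - 1) / real q"
    using q by (simp add: field_simps)
  finally show "?a \<le> 2 * (1 + (real k - 1) / (real D + 1 - real k)) * ?o + real D * real (card V)"
    by (simp add: q(1))
qed

lemma competitive_mono:
  assumes "competitive V m k c A" "c \<le> c'"
  shows "competitive V m k c' A"
proof -
  obtain d where "\<And>\<sigma>. \<sigma> \<in> lists (edges V) \<Longrightarrow>
      real (alg_cost m A \<sigma>) \<le> c * real (opt_cost V k \<sigma>) + d"
    using assms(1) by (auto simp: competitive_def)
  moreover have "c * real (opt_cost V k \<sigma>) \<le> c' * real (opt_cost V k \<sigma>)" for \<sigma>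
    using assms(2) by (intro mult_right_mono) auto
  ultimately show ?thesis
    unfolding competitive_def by (meson add_right_mono order_trans)
qed

theorem theorem27:
  "\<exists>K>0::real. \<forall>(V::nat set) (k::nat) (h::nat).
     finite V \<longrightarrow> k \<ge> 1 \<longrightarrow> real h \<ge> real k - 1 \<longrightarrow>
     (\<exists>A. is_online_algorithm V (k + h) A \<and>
          competitive V (k + h) k
            (2 * (1 + (real k - 1) / real_of_int \<lfloor>(real h + 3 - real k) / 2\<rfloor>)) A \<and>
          (\<forall>\<alpha>>0. real h = (1 + \<alpha>) * real k \<longrightarrow>
             competitive V (k + h) k (K * (1 + 1 / \<alpha>)) A))"
proof (intro exI[of _ 4] conjI allI impI)
  fix V :: "nat set" and k h :: nat
  assume V: "finite V" and k: "k \<ge> 1" and h: "real h \<ge> real k - 1"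
  \<comment> \<open>The largest \<open>D\<close> with \<open>2 * D - 1 \<le> k + h\<close>; the
    assumption on \<open>h\<close> says that \<open>D \<ge> k\<close>.\<close>
  define D where "D = (k + h + 1) div 2"
  define A :: "nat algorithm" where "A = (\<lambda>\<sigma>. snd (state (k + h) D \<sigma>))"
  have D: "2 * D - 1 \<le> k + h" "k \<le> D" using h by (auto simp: D_def)
  \<comment> \<open>The argument of the floor is \<open>(k + h + 1) / 2 + 1 - k\<close>, and
    \<open>D\<close> is the floor of its first summand.\<close>
  have "\<lfloor>(real h + 3 - real k) / 2\<rfloor> = int D + 1 - int k"
  proof -
    have "2 * D \<le> k + h + 1" "k + h + 1 \<le> 2 * D + 1" by (auto simp: D_def)
    then have "2 * real D \<le> real k + real h + 1" "real k + real h + 1 \<le> 2 * real D + 1"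
      by linarith+
    then show ?thesis by (intro floor_unique) auto
  qed
  then have q: "real_of_int \<lfloor>(real h + 3 - real k) / 2\<rfloor> = real D + 1 - real k" by simp
  have comp: "competitive V (k + h) k
      (2 * (1 + (real k - 1) / real_of_int \<lfloor>(real h + 3 - real k) / 2\<rfloor>)) A"
    unfolding A_def q by (rule state_competitive) (use D k V in auto)
  have "competitive V (k + h) k (4 * (1 + 1 / \<alpha>)) A"
    if \<alpha>: "\<alpha> > 0" "real h = (1 + \<alpha>) * real k" for \<alpha>
  proof (rule competitive_mono[OF comp])
    let ?q = "real_of_int \<lfloor>(real h + 3 - real k) / 2\<rfloor>"
    \<comment> \<open>Here \<open>h - k = \<alpha> * k\<close>, so the floor exceeds
      \<open>(\<alpha> * k + 3) / 2 - 1\<close>.\<close>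
    have "\<alpha> * real k / 2 \<le> ?q"
      using real_of_int_floor_gt_diff_one[of "(real h + 3 - real k) / 2"] \<alpha>
      by (simp add: algebra_simps del: real_of_int_floor_gt_diff_one)
    moreover have pos: "\<alpha> * real k / 2 > 0" using \<alpha> k by simp
    ultimately have "(real k - 1) / ?q \<le> real k / (\<alpha> * real k / 2)"
      using k by (intro frac_le) auto
    also have "\<dots> = 2 / \<alpha>" using k by simp
    finally have "2 * (1 + (real k - 1) / ?q) \<le> 2 * (1 + 2 / \<alpha>)"
      by (intro mult_left_mono add_left_mono) auto
    \<comment> \<open>The term \<open>4 / \<alpha>\<close> on the left dictates the constant
      4.\<close>
    also have "\<dots> \<le> 4 * (1 + 1 / \<alpha>)" by simp
    finally show "2 * (1 + (real k - 1) / ?q) \<le> 4 * (1 + 1 / \<alpha>)" .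
  qed
  then show "\<exists>A. is_online_algorithm V (k + h) A \<and>
      competitive V (k + h) k
        (2 * (1 + (real k - 1) / real_of_int \<lfloor>(real h + 3 - real k) / 2\<rfloor>)) A \<and>
      (\<forall>\<alpha>>0. real h = (1 + \<alpha>) * real k \<longrightarrow> competitive V (k + h) k (4 * (1 + 1 / \<alpha>)) A)"
    using comp state_online[OF D(1)] k D(2) by (intro exI[of _ A]) (auto simp: A_def)
qed simp

end
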